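(* Let $\varepsilon\in\{-1,1\}$, let $\Omega\subset Q_\varepsilon^2$ be a domain, let $u\in C^2(\Omega)$, and define $X_u:\Omega\to\mathbb{L}^3$ by $$X_u(p)=\varepsilon u(p)\,p+\nabla u(p).$$ Then $$dX_u=\operatorname{Hess}u+\varepsilon u\operatorname{Id}.$$ In particular, $dX_u(T_pQ_\varepsilon^2)\subset T_pQ_\varepsilon^2$ and $\langle X_u,p\rangle=u$.
   Context: $\mathbb{L}^3=(\mathbb{R}^3,\langle\,,\,\rangle)$ is Lorentz--Minkowski space of signature $(+,+,-)$, and $Q_\varepsilon^2=\{p\in\mathbb{L}^3:\langle p,p\rangle=\varepsilon\}$ with the induced metric; for $\varepsilon=-1$ only the upper sheet is taken, so $Q_{-1}^2=\mathbb{H}^2$ is the (Riemannian) hyperbolic plane, and $Q_1^2=\mathbb{S}^2_1$ is the (Lorentzian) de Sitter plane. $\nabla$ is the Levi-Civita connection of $Q_\varepsilon^2$, $\nabla u$ is the gradient of $u$ regarded as a vector in $T_pQ_\varepsilon^2=p^\perp\subset\mathbb{L}^3$, and $\operatorname{Hess}u$ is the endomorphism $\operatorname{Hess}u(Y)=\nabla_Y\nabla u$ of $T_pQ_\varepsilon^2$. The differential $dX_u$ at $p$ is a linear map $T_pQ_\varepsilon^2\to\mathbb{L}^3$. *)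

theory Defs
  imports "HOL-Analysis.Analysis"
begin

type_synonym L3 = "real ^ 3"

definition mink :: "L3 \<Rightarrow> L3 \<Rightarrow> real" where
  "mink x y = x $ 1 * y $ 1 + x $ 2 * y $ 2 - x $ 3 * y $ 3"

definition Q :: "real \<Rightarrow> L3 set" where
  "Q \<epsilon> = {p. mink p p = \<epsilon> \<and> (\<epsilon> = - 1 \<longrightarrow> p $ 3 > 0)}"

definition tspace :: "L3 \<Rightarrow> L3 set" where
  "tspace p = {v. mink v p = 0}"

definition domain_in :: "real \<Rightarrow> L3 set \<Rightarrow> bool" where
  "domain_in \<epsilon> \<Omega> \<longleftrightarrow> openin (top_of_set (Q \<epsilon>)) \<Omega> \<and> connected \<Omega> \<and> \<Omega> \<noteq> {}"

text \<open>A function on a subset of the surface is \<open>C\<^sup>k\<close> if it extends locally to a \<open>C\<^sup>k\<close> function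
  on an open subset of the ambient space. Maps on \<open>\<Omega>\<close> are total functions in HOL; none of
  the notions below depends on their values off \<open>\<Omega>\<close>.\<close>

definition C1_open :: "L3 set \<Rightarrow> (L3 \<Rightarrow> 'b::real_normed_vector) \<Rightarrow> bool" where
  "C1_open U F \<longleftrightarrow> (\<exists>F' :: L3 \<Rightarrow> (L3 \<Rightarrow>\<^sub>L 'b).
     (\<forall>x\<in>U. (F has_derivative blinfun_apply (F' x)) (at x)) \<and> continuous_on U F')"

definition C2_open :: "L3 set \<Rightarrow> (L3 \<Rightarrow> 'b::real_normed_vector) \<Rightarrow> bool" where
  "C2_open U F \<longleftrightarrow> (\<exists>F' :: L3 \<Rightarrow> (L3 \<Rightarrow>\<^sub>L 'b).
     (\<forall>x\<in>U. (F has_derivative blinfun_apply (F' x)) (at x)) \<and> C1_open U F')"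

definition C1_surf :: "L3 set \<Rightarrow> (L3 \<Rightarrow> 'b::real_normed_vector) \<Rightarrow> bool" where
  "C1_surf \<Omega> f \<longleftrightarrow> (\<forall>p\<in>\<Omega>. \<exists>U F. open U \<and> p \<in> U \<and> C1_open U F \<and> (\<forall>x\<in>U \<inter> \<Omega>. F x = f x))"

definition C2_surf :: "L3 set \<Rightarrow> (L3 \<Rightarrow> 'b::real_normed_vector) \<Rightarrow> bool" where
  "C2_surf \<Omega> f \<longleftrightarrow> (\<forall>p\<in>\<Omega>. \<exists>U F. open U \<and> p \<in> U \<and> C2_open U F \<and> (\<forall>x\<in>U \<inter> \<Omega>. F x = f x))"

text \<open>The differential at \<open>p\<close>, to be applied to vectors of \<open>tspace p\<close> only: the Frechet derivative
  within \<open>\<Omega>\<close> is arbitrary in directions transversal to the surface, but it is unique on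
  \<open>tspace p\<close> (lemma \<open>differential_eq\<close>).\<close>

definition differential :: "L3 set \<Rightarrow> (L3 \<Rightarrow> 'b::real_normed_vector) \<Rightarrow> L3 \<Rightarrow> L3 \<Rightarrow> 'b" where
  "differential \<Omega> f p = frechet_derivative f (at p within \<Omega>)"

definition grad :: "L3 set \<Rightarrow> (L3 \<Rightarrow> real) \<Rightarrow> L3 \<Rightarrow> L3" where
  "grad \<Omega> u p = (THE w. w \<in> tspace p \<and> (\<forall>v\<in>tspace p. mink w v = differential \<Omega> u p v))"

definition vfields :: "L3 set \<Rightarrow> (L3 \<Rightarrow> L3) set" where
  "vfields \<Omega> = {Y. C1_surf \<Omega> Y \<and> (\<forall>p\<in>\<Omega>. Y p \<in> tspace p)}"

text \<open>The Levi-Civita connection of \<open>\<Omega>\<close> with the metric induced by \<open>mink\<close> is characterised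
  intrinsically; \<open>levi_civita_exists\<close> below shows that there is one.
  \<open>nab p v Y\<close> stands for the covariant derivative at \<open>p \<in> \<Omega>\<close> of the \<open>C\<^sup>1\<close> tangent field \<open>Y\<close>
  on \<open>\<Omega>\<close> in the direction \<open>v \<in> tspace p\<close>.\<close>

type_synonym conn = "L3 \<Rightarrow> L3 \<Rightarrow> (L3 \<Rightarrow> L3) \<Rightarrow> L3"

definition affine_connection :: "L3 set \<Rightarrow> conn \<Rightarrow> bool" where
  "affine_connection \<Omega> nab \<longleftrightarrow>
     (\<forall>p\<in>\<Omega>. \<forall>Y\<in>vfields \<Omega>. \<forall>v\<in>tspace p. nab p v Y \<in> tspace p) \<and>
     (\<forall>p\<in>\<Omega>. \<forall>Y\<in>vfields \<Omega>. \<forall>v\<in>tspace p. \<forall>w\<in>tspace p. \<forall>a b.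
        nab p (a *\<^sub>R v + b *\<^sub>R w) Y = a *\<^sub>R nab p v Y + b *\<^sub>R nab p w Y) \<and>
     (\<forall>p\<in>\<Omega>. \<forall>Y\<in>vfields \<Omega>. \<forall>Z\<in>vfields \<Omega>. \<forall>v\<in>tspace p.
        nab p v (\<lambda>q. Y q + Z q) = nab p v Y + nab p v Z) \<and>
     (\<forall>p\<in>\<Omega>. \<forall>Y\<in>vfields \<Omega>. \<forall>v\<in>tspace p. \<forall>f::L3 \<Rightarrow> real. C1_surf \<Omega> f \<longrightarrow>
        nab p v (\<lambda>q. f q *\<^sub>R Y q) = differential \<Omega> f p v *\<^sub>R Y p + f p *\<^sub>R nab p v Y)"

definition metric_compatible :: "L3 set \<Rightarrow> conn \<Rightarrow> bool" where
  "metric_compatible \<Omega> nab \<longleftrightarrow>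
     (\<forall>p\<in>\<Omega>. \<forall>Y\<in>vfields \<Omega>. \<forall>Z\<in>vfields \<Omega>. \<forall>v\<in>tspace p.
        differential \<Omega> (\<lambda>q. mink (Y q) (Z q)) p v
          = mink (nab p v Y) (Z p) + mink (Y p) (nab p v Z))"

definition act :: "L3 set \<Rightarrow> (L3 \<Rightarrow> L3) \<Rightarrow> (L3 \<Rightarrow> real) \<Rightarrow> L3 \<Rightarrow> real" where
  "act \<Omega> X f q = differential \<Omega> f q (X q)"

text \<open>The equation \<open>\<nabla>\<^sub>X Y - \<nabla>\<^sub>Y X = [X, Y]\<close>, with both sides acting as derivations on
  \<open>C\<^sup>2\<close> functions.\<close>

definition torsion_free :: "L3 set \<Rightarrow> conn \<Rightarrow> bool" where
  "torsion_free \<Omega> nab \<longleftrightarrow>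
     (\<forall>p\<in>\<Omega>. \<forall>X\<in>vfields \<Omega>. \<forall>Y\<in>vfields \<Omega>. \<forall>f. C2_surf \<Omega> f \<longrightarrow>
        differential \<Omega> f p (nab p (X p) Y - nab p (Y p) X)
          = act \<Omega> X (act \<Omega> Y f) p - act \<Omega> Y (act \<Omega> X f) p)"

definition levi_civita :: "L3 set \<Rightarrow> conn \<Rightarrow> bool" where
  "levi_civita \<Omega> nab \<longleftrightarrow>
     affine_connection \<Omega> nab \<and> metric_compatible \<Omega> nab \<and> torsion_free \<Omega> nab"

definition Hess :: "L3 set \<Rightarrow> conn \<Rightarrow> (L3 \<Rightarrow> real) \<Rightarrow> L3 \<Rightarrow> L3 \<Rightarrow> L3" where
  "Hess \<Omega> nab u p v = nab p v (grad \<Omega> u)"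

definition Xmap :: "real \<Rightarrow> L3 set \<Rightarrow> (L3 \<Rightarrow> real) \<Rightarrow> L3 \<Rightarrow> L3" where
  "Xmap \<epsilon> \<Omega> u p = (\<epsilon> * u p) *\<^sub>R p + grad \<Omega> u p"


subsection \<open>The differential is well defined on tangent vectors\<close>

lemma bounded_bilinear_mink: "bounded_bilinear mink"
proof -
  have "bilinear mink"
    unfolding bilinear_def mink_def
    by (auto intro!: linearI simp: algebra_simps)
  then show ?thesis
    by (simp add: bilinear_conv_bounded_bilinear)
qed

interpretation mink: bounded_bilinear mink
  by (rule bounded_bilinear_mink)

lemma mink_commute: "mink x y = mink y x"
  by (simp add: mink_def)

lemma curve_in_surface:
  assumes e: "\<epsilon> \<in> {-1, 1}" and op: "openin (top_of_set (Q \<epsilon>)) \<Omega>"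
    and p: "p \<in> \<Omega>" and v: "v \<in> tspace p"
  obtains \<gamma> :: "real \<Rightarrow> L3" and d where "d > 0" "\<gamma> 0 = p" "\<gamma> ` {-d<..<d} \<subseteq> \<Omega>"
    "(\<gamma> has_derivative (\<lambda>t. t *\<^sub>R v)) (at 0)"
proof -
  obtain U where U: "open U" "\<Omega> = Q \<epsilon> \<inter> U"
    using op by (auto simp: openin_open)
  define g where "g t = 1 + \<epsilon> * t\<^sup>2 * mink v v" for t :: real
  define \<gamma> where "\<gamma> t = inverse (sqrt (g t)) *\<^sub>R (p + t *\<^sub>R v)" for t
  have pQ: "mink p p = \<epsilon>" "\<epsilon> = -1 \<longrightarrow> p $ 3 > 0" "p \<in> U"
    using p U by (auto simp: Q_def)
  have pv: "mink p v = 0" "mink v p = 0"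
    using v by (auto simp: tspace_def mink_commute)
  have g0: "\<gamma> 0 = p" by (simp add: \<gamma>_def g_def)
  have der: "(\<gamma> has_derivative (\<lambda>t. t *\<^sub>R v)) (at 0)"
    unfolding \<gamma>_def g_def
    by (auto intro!: derivative_eq_intros)
  then have cont: "isCont \<gamma> 0" by (rule has_derivative_continuous)
  have ev1: "\<forall>\<^sub>F t in nhds 0. \<gamma> t \<in> U"
  proof -
    have "(\<gamma> \<longlongrightarrow> \<gamma> 0) (nhds 0)"
      using cont by (simp add: tendsto_at_iff_tendsto_nhds continuous_at)
    then show ?thesis
      using U(1) pQ(3) g0 by (auto dest!: topological_tendstoD)
  qed
  have "isCont (\<lambda>t. \<gamma> t $ 3) 0"
    using cont by (intro continuous_intros)
  then have ev2: "\<forall>\<^sub>F t in nhds 0. \<epsilon> = -1 \<longrightarrow> \<gamma> t $ 3 > 0"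
  proof (cases "\<epsilon> = -1")
    case True
    have "((\<lambda>t. \<gamma> t $ 3) \<longlongrightarrow> \<gamma> 0 $ 3) (nhds 0)"
      using \<open>isCont (\<lambda>t. \<gamma> t $ 3) 0\<close> tendsto_at_iff_tendsto_nhds[of "\<lambda>t. \<gamma> t $ 3" 0]
      by (simp add: continuous_at)
    then have "\<forall>\<^sub>F t in nhds 0. \<gamma> t $ 3 > 0"
      using pQ(2) True g0 by (intro order_tendstoD(1)[where y = "\<gamma> 0 $ 3"]) auto
    then show ?thesis by (auto elim: eventually_mono)
  qed auto
  have "isCont g 0" unfolding g_def by (intro continuous_intros)
  then have "(g \<longlongrightarrow> g 0) (nhds 0)"
    by (simp add: tendsto_at_iff_tendsto_nhds continuous_at)
  then have ev3: "\<forall>\<^sub>F t in nhds 0. g t > 0"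
    by (rule order_tendstoD(1)) (simp add: g_def)
  have Q: "mink (\<gamma> t) (\<gamma> t) = \<epsilon>" if "g t > 0" for t
  proof -
    have "mink (\<gamma> t) (\<gamma> t) = inverse (sqrt (g t)) * inverse (sqrt (g t)) * (\<epsilon> + t\<^sup>2 * mink v v)"
      by (simp add: \<gamma>_def mink.scaleR_left mink.scaleR_right mink.add_left mink.add_right pQ pv
          power2_eq_square algebra_simps)
    also have "inverse (sqrt (g t)) * inverse (sqrt (g t)) = inverse (g t)"
      using that by (simp flip: inverse_mult_distrib)
    also have "\<epsilon> + t\<^sup>2 * mink v v = \<epsilon> * g t"
      using e by (auto simp: g_def algebra_simps)
    finally show ?thesis using that by simp
  qed
  have "\<forall>\<^sub>F t in nhds 0. \<gamma> t \<in> \<Omega>"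
    using ev1 ev2 ev3 by eventually_elim (use Q U in \<open>auto simp: Q_def\<close>)
  then obtain d where "d > 0" "\<And>t. dist t 0 < d \<Longrightarrow> \<gamma> t \<in> \<Omega>"
    by (auto simp: eventually_nhds_metric)
  then have "\<gamma> ` {-d<..<d} \<subseteq> \<Omega>" by (auto simp: dist_real_def)
  with that \<open>d > 0\<close> g0 der show ?thesis by blast
qed

lemma derivative_tspace_unique:
  assumes e: "\<epsilon> \<in> {-1, 1}" and op: "openin (top_of_set (Q \<epsilon>)) \<Omega>"
    and p: "p \<in> \<Omega>" and v: "v \<in> tspace p"
    and D: "(f has_derivative D) (at p within \<Omega>)" and E: "(f has_derivative E) (at p within \<Omega>)"
  shows "D v = E v"
proof -
  obtain \<gamma> d where \<gamma>: "d > 0" "\<gamma> 0 = p" "\<gamma> ` {-d<..<d} \<subseteq> \<Omega>"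
    "(\<gamma> has_derivative (\<lambda>t. t *\<^sub>R v)) (at 0)"
    using curve_in_surface[OF e op p v] by blast
  have *: "((\<lambda>t. f (\<gamma> t)) has_derivative (\<lambda>t. A (t *\<^sub>R v))) (at 0)"
    if "(f has_derivative A) (at p within \<Omega>)" for A
  proof -
    have "(f has_derivative A) (at (\<gamma> 0) within \<gamma> ` {-d<..<d})"
      using that \<gamma> has_derivative_subset by blast
    then have "((\<lambda>t. f (\<gamma> t)) has_derivative (\<lambda>t. A (t *\<^sub>R v))) (at 0 within {-d<..<d})"
      using has_derivative_in_compose[OF has_derivative_at_withinI[OF \<gamma>(4)]] by blast
    then show ?thesis using \<gamma>(1) by (simp add: at_within_open[of 0 "{-d<..<d}"])
  qed
  have "(\<lambda>t::real. D (t *\<^sub>R v)) = (\<lambda>t. E (t *\<^sub>R v))"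
    using has_derivative_unique[OF *[OF D] *[OF E]] .
  then have "D (1 *\<^sub>R v) = E (1 *\<^sub>R v)" by (rule fun_cong)
  then show ?thesis by simp
qed

lemma differential_eq:
  assumes "\<epsilon> \<in> {-1, 1}" and "openin (top_of_set (Q \<epsilon>)) \<Omega>" and "p \<in> \<Omega>" and "v \<in> tspace p"
    and D: "(f has_derivative D) (at p within \<Omega>)"
  shows "differential \<Omega> f p v = D v"
proof -
  have "f differentiable (at p within \<Omega>)" using D by (auto simp: differentiable_def)
  then have "(f has_derivative differential \<Omega> f p) (at p within \<Omega>)"
    unfolding differential_def by (simp add: frechet_derivative_works)
  with derivative_tspace_unique assms show ?thesis by blast
qed


subsection \<open>Existence of the Levi-Civita connection\<close>

lemma has_derivative_restrict:
  assumes F: "(F has_derivative D) (at p within \<Omega>)" and U: "open U" "p \<in> U" "p \<in> \<Omega>"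
    and eq: "\<And>x. x \<in> U \<Longrightarrow> x \<in> \<Omega> \<Longrightarrow> F x = f x"
  shows "(f has_derivative D) (at p within \<Omega>)"
proof -
  obtain d where "d > 0" "\<And>y. dist y p < d \<Longrightarrow> y \<in> U"
    using U by (metis open_dist)
  then show ?thesis
    using has_derivative_transform_within[OF F _ U(3), of d f] eq by blast
qed

lemma C1_surf_derivative:
  assumes "C1_surf \<Omega> f" "p \<in> \<Omega>"
  shows "(f has_derivative differential \<Omega> f p) (at p within \<Omega>)"
proof -
  obtain U F where U: "open U" "p \<in> U" "C1_open U F" "\<forall>x\<in>U \<inter> \<Omega>. F x = f x"
    using assms by (auto simp: C1_surf_def)
  obtain F' where F': "(F has_derivative F') (at p)"
    using U by (auto simp: C1_open_def)
  have "(f has_derivative F') (at p within \<Omega>)"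
    by (rule has_derivative_restrict[OF has_derivative_at_withinI[OF F'] U(1,2)])
       (use U assms in auto)
  then show ?thesis
    unfolding differential_def by (auto simp flip: frechet_derivative_works simp: differentiable_def)
qed

lemma second_difference:
  fixes F :: "L3 \<Rightarrow> real" and F' :: "L3 \<Rightarrow> (L3 \<Rightarrow>\<^sub>L real)"
  assumes U: "open U" "p \<in> U"
    and F': "\<And>x. x \<in> U \<Longrightarrow> (F has_derivative blinfun_apply (F' x)) (at x)"
    and F'': "(F' has_derivative F'') (at p)"
  shows "((\<lambda>t. (F (p + t *\<^sub>R v + t *\<^sub>R w) - F (p + t *\<^sub>R v) - F (p + t *\<^sub>R w) + F p) / t\<^sup>2)
          \<longlongrightarrow> F'' w v) (at_right 0)"
proof (rule tendstoI)
  fix e :: real assume "e > 0"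
  define C where "C = (2 * norm v + norm w) * norm v + 1"
  have "C > 0" by (simp add: C_def add_nonneg_pos)
  define \<eta> where "\<eta> = e / C"
  have "\<eta> > 0" using \<open>e > 0\<close> \<open>C > 0\<close> by (simp add: \<eta>_def)
  interpret F'': bounded_linear F'' using F'' by (rule has_derivative_bounded_linear)
  obtain d1 where d1: "d1 > 0"
    "\<And>y. norm (y - p) < d1 \<Longrightarrow> norm (F' y - F' p - F'' (y - p)) \<le> \<eta> * norm (y - p)"
    using F'' \<open>\<eta> > 0\<close> unfolding has_derivative_at_alt by blast
  obtain d2 where d2: "d2 > 0" "\<And>y. norm (y - p) < d2 \<Longrightarrow> y \<in> U"
    using U by (metis open_dist dist_norm)
  define d where "d = min d1 d2"
  have d: "d > 0" "\<And>y. norm (y - p) < d \<Longrightarrow> y \<in> U"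
    "\<And>y. norm (y - p) < d \<Longrightarrow> norm (F' y - F' p - F'' (y - p)) \<le> \<eta> * norm (y - p)"
    using d1 d2 by (auto simp: d_def)
  define \<delta> where "\<delta> = d / (norm v + norm w + 1)"
  have "\<delta> > 0" using d(1) by (simp add: \<delta>_def add_nonneg_pos)
  have "dist ((F (p + t *\<^sub>R v + t *\<^sub>R w) - F (p + t *\<^sub>R v) - F (p + t *\<^sub>R w) + F p) / t\<^sup>2) (F'' w v) < e"
    if t: "0 < t" "t < \<delta>" for t
  proof -
    have tb: "t * (norm v + norm w) < d"
    proof -
      have "t * (norm v + norm w) \<le> t * (norm v + norm w + 1)"
        using t by (intro mult_left_mono) auto
      also have "\<dots> < d"
      proof -
        have "norm v + norm w + 1 > 0" by (simp add: add_nonneg_pos)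
        then show ?thesis using t by (simp add: \<delta>_def pos_less_divide_eq)
      qed
      finally show ?thesis .
    qed
    have n1: "norm (s *\<^sub>R v + t *\<^sub>R w) < d" "norm (s *\<^sub>R v) < d"
      "norm (s *\<^sub>R v + t *\<^sub>R w) \<le> t * (norm v + norm w)" "norm (s *\<^sub>R v) \<le> t * norm v"
      if "0 \<le> s" "s \<le> t" for s
    proof -
      show b: "norm (s *\<^sub>R v) \<le> t * norm v" using that by (simp add: mult_right_mono)
      show a: "norm (s *\<^sub>R v + t *\<^sub>R w) \<le> t * (norm v + norm w)"
        using norm_triangle_ineq[of "s *\<^sub>R v" "t *\<^sub>R w"] b t by (simp add: algebra_simps)
      show "norm (s *\<^sub>R v + t *\<^sub>R w) < d" using a tb by simp
      have "0 \<le> t * norm w" using t by simp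
      then show "norm (s *\<^sub>R v) < d" using b tb by (simp add: algebra_simps)
    qed
    define g where "g s = F (p + s *\<^sub>R v + t *\<^sub>R w) - F (p + s *\<^sub>R v)" for s
    have gd: "(g has_real_derivative
        (F' (p + s *\<^sub>R v + t *\<^sub>R w) v - F' (p + s *\<^sub>R v) v)) (at s)"
      if s: "0 \<le> s" "s \<le> t" for s
    proof -
      have in1: "p + s *\<^sub>R v + t *\<^sub>R w \<in> U" "p + s *\<^sub>R v \<in> U"
        using n1[OF s] d(2)[of "p + s *\<^sub>R v + t *\<^sub>R w"] d(2)[of "p + s *\<^sub>R v"]
        by (auto simp: add.assoc)
      have i1: "((\<lambda>s. p + s *\<^sub>R v + t *\<^sub>R w) has_derivative (\<lambda>h. h *\<^sub>R v)) (at s)"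
        by (auto intro!: derivative_eq_intros)
      have i2: "((\<lambda>s. p + s *\<^sub>R v) has_derivative (\<lambda>h. h *\<^sub>R v)) (at s)"
        by (auto intro!: derivative_eq_intros)
      have "(g has_derivative (\<lambda>h. F' (p + s *\<^sub>R v + t *\<^sub>R w) (h *\<^sub>R v) - F' (p + s *\<^sub>R v) (h *\<^sub>R v))) (at s)"
        unfolding g_def
        by (intro has_derivative_diff has_derivative_compose[OF i1 F'[OF in1(1)]]
            has_derivative_compose[OF i2 F'[OF in1(2)]])
      then show ?thesis
        unfolding has_field_derivative_def
        by (rule has_derivative_eq_rhs) (auto simp: blinfun.scaleR_right algebra_simps)
    qed
    obtain z where z: "0 < z" "z < t"
      "g t - g 0 = (t - 0) * (F' (p + z *\<^sub>R v + t *\<^sub>R w) v - F' (p + z *\<^sub>R v) v)"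
      using MVT2[OF t(1) gd] by blast
    define R1 where "R1 = F' (p + z *\<^sub>R v + t *\<^sub>R w) - F' p - F'' (z *\<^sub>R v + t *\<^sub>R w)"
    define R2 where "R2 = F' (p + z *\<^sub>R v) - F' p - F'' (z *\<^sub>R v)"
    have r1: "norm R1 \<le> \<eta> * (t * (norm v + norm w))"
    proof -
      have "norm R1 \<le> \<eta> * norm (z *\<^sub>R v + t *\<^sub>R w)"
        using d(3)[of "p + z *\<^sub>R v + t *\<^sub>R w"] n1[of z] z by (simp add: R1_def add.assoc)
      also have "\<dots> \<le> \<eta> * (t * (norm v + norm w))"
        using n1[of z] z \<open>\<eta> > 0\<close> by (intro mult_left_mono) auto
      finally show ?thesis .
    qed
    have r2: "norm R2 \<le> \<eta> * (t * norm v)"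
    proof -
      have "norm R2 \<le> \<eta> * norm (z *\<^sub>R v)"
        using d(3)[of "p + z *\<^sub>R v"] n1[of z] z by (simp add: R2_def)
      also have "\<dots> \<le> \<eta> * (t * norm v)"
        using n1[of z] z \<open>\<eta> > 0\<close> by (intro mult_left_mono) auto
      finally show ?thesis .
    qed
    have "F' (p + z *\<^sub>R v + t *\<^sub>R w) - F' (p + z *\<^sub>R v) = t *\<^sub>R F'' w + R1 - R2"
      by (simp add: R1_def R2_def F''.add F''.scaleR)
    then have "F' (p + z *\<^sub>R v + t *\<^sub>R w) v - F' (p + z *\<^sub>R v) v = t * F'' w v + (R1 - R2) v"
      by (simp flip: blinfun.diff_left) (simp add: blinfun.add_left blinfun.diff_left blinfun.scaleR_left)
    then have "g t - g 0 = t * (t * F'' w v + (R1 - R2) v)" using z by simp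
    then have "(g t - g 0) / t\<^sup>2 - F'' w v = (R1 - R2) v / t"
      using t by (simp add: field_simps power2_eq_square)
    moreover have "\<bar>(R1 - R2) v / t\<bar> < e"
    proof -
      have "\<bar>(R1 - R2) v\<bar> \<le> norm (R1 - R2) * norm v"
        using norm_blinfun[of "R1 - R2" v] by simp
      also have "\<dots> \<le> (\<eta> * (t * (norm v + norm w)) + \<eta> * (t * norm v)) * norm v"
        using norm_triangle_ineq4[of R1 R2] r1 r2 by (intro mult_right_mono) auto
      also have "\<dots> = t * (\<eta> * (C - 1))" by (simp add: C_def algebra_simps)
      also have "\<dots> < t * e"
        using t \<open>C > 0\<close> \<open>e > 0\<close> by (simp add: \<eta>_def field_simps)
      finally show ?thesis using t by (simp add: field_simps)
    qed
    moreover have "g t - g 0 = F (p + t *\<^sub>R v + t *\<^sub>R w) - F (p + t *\<^sub>R v) - F (p + t *\<^sub>R w) + F p"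
      by (simp add: g_def)
    ultimately show ?thesis by (simp add: dist_real_def)
  qed
  then show "\<forall>\<^sub>F t in at_right 0. dist ((F (p + t *\<^sub>R v + t *\<^sub>R w) - F (p + t *\<^sub>R v)
      - F (p + t *\<^sub>R w) + F p) / t\<^sup>2) (F'' w v) < e"
    using \<open>\<delta> > 0\<close> unfolding eventually_at_right_field by blast
qed

lemma second_derivative_symmetric:
  fixes F :: "L3 \<Rightarrow> real" and F' :: "L3 \<Rightarrow> (L3 \<Rightarrow>\<^sub>L real)"
  assumes "open U" "p \<in> U"
    and "\<And>x. x \<in> U \<Longrightarrow> (F has_derivative blinfun_apply (F' x)) (at x)"
    and "(F' has_derivative F'') (at p)"
  shows "F'' w v = F'' v w"
proof -
  have 1: "((\<lambda>t. (F (p + t *\<^sub>R w + t *\<^sub>R v) - F (p + t *\<^sub>R w) - F (p + t *\<^sub>R v) + F p) / t\<^sup>2)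
          \<longlongrightarrow> F'' v w) (at_right 0)"
    by (rule second_difference[OF assms])
  have "(\<lambda>t. (F (p + t *\<^sub>R w + t *\<^sub>R v) - F (p + t *\<^sub>R w) - F (p + t *\<^sub>R v) + F p) / t\<^sup>2)
      = (\<lambda>t. (F (p + t *\<^sub>R v + t *\<^sub>R w) - F (p + t *\<^sub>R v) - F (p + t *\<^sub>R w) + F p) / t\<^sup>2)"
    by (rule ext) (simp add: algebra_simps)
  with 1 have "((\<lambda>t. (F (p + t *\<^sub>R v + t *\<^sub>R w) - F (p + t *\<^sub>R v) - F (p + t *\<^sub>R w) + F p) / t\<^sup>2)
          \<longlongrightarrow> F'' v w) (at_right 0)" by simp
  then show ?thesis
    using second_difference[OF assms, of v w]
    by (intro tendsto_unique[OF trivial_limit_at_right_real])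
qed

lemma act_act:
  assumes e: "\<epsilon> \<in> {-1, 1}" and op: "openin (top_of_set (Q \<epsilon>)) \<Omega>" and p: "p \<in> \<Omega>"
    and U: "open U" "p \<in> U" "\<forall>x\<in>U \<inter> \<Omega>. F x = f x"
    and F': "\<And>x. x \<in> U \<Longrightarrow> (F has_derivative blinfun_apply (F' x)) (at x)"
    and F'': "(F' has_derivative F'') (at p)"
    and X: "X \<in> vfields \<Omega>" and Y: "Y \<in> vfields \<Omega>"
  shows "act \<Omega> X (act \<Omega> Y f) p = F'' (X p) (Y p) + F' p (differential \<Omega> Y p (X p))"
proof -
  have act: "act \<Omega> Y f q = F' q (Y q)" if "q \<in> U" "q \<in> \<Omega>" for q
  proof -
    have "(f has_derivative blinfun_apply (F' q)) (at q within \<Omega>)"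
      by (rule has_derivative_restrict[OF has_derivative_at_withinI[OF F'] U(1)])
         (use that U in auto)
    then show ?thesis
      unfolding act_def using differential_eq[OF e op that(2)] Y that by (auto simp: vfields_def)
  qed
  have "(Y has_derivative differential \<Omega> Y p) (at p within \<Omega>)"
    using C1_surf_derivative Y p by (auto simp: vfields_def)
  then have "((\<lambda>q. F' q (Y q)) has_derivative
      (\<lambda>h. F' p (differential \<Omega> Y p h) + F'' h (Y p))) (at p within \<Omega>)"
    using blinfun.FDERIV[OF has_derivative_at_withinI[OF F'']] by blast
  then have "(act \<Omega> Y f has_derivative
      (\<lambda>h. F' p (differential \<Omega> Y p h) + F'' h (Y p))) (at p within \<Omega>)"
    by (rule has_derivative_restrict[OF _ U(1,2)]) (use p act in auto)
  then show ?thesis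
    unfolding act_def[of \<Omega> X] using differential_eq[OF e op p] X p
    by (auto simp: vfields_def add.commute)
qed

theorem levi_civita_exists:
  assumes e: "\<epsilon> \<in> {-1, 1}" and op: "openin (top_of_set (Q \<epsilon>)) \<Omega>"
  shows "levi_civita \<Omega>
    (\<lambda>p v Y. differential \<Omega> Y p v - (\<epsilon> * mink (differential \<Omega> Y p v) p) *\<^sub>R p)"
    (is "levi_civita \<Omega> ?nab")
proof -
  note deq = differential_eq[OF e op]
  have pp: "mink p p = \<epsilon>" if "p \<in> \<Omega>" for p
    using that op by (auto simp: openin_open Q_def)
  have ee: "\<epsilon> * \<epsilon> = 1" using e by auto
  have der: "(Y has_derivative differential \<Omega> Y p) (at p within \<Omega>)"
    if "Y \<in> vfields \<Omega>" "p \<in> \<Omega>" for Y p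
    using that C1_surf_derivative by (auto simp: vfields_def)
  have tan: "?nab p v Y \<in> tspace p" if "p \<in> \<Omega>" for p v Y
    using pp[OF that] ee by (simp add: tspace_def mink.diff_left mink.scaleR_left algebra_simps)
  have lin: "?nab p (a *\<^sub>R v + b *\<^sub>R w) Y = a *\<^sub>R ?nab p v Y + b *\<^sub>R ?nab p w Y"
    if "p \<in> \<Omega>" "Y \<in> vfields \<Omega>" for p v w Y a b
  proof -
    interpret D: bounded_linear "differential \<Omega> Y p"
      using der that has_derivative_bounded_linear by blast
    show ?thesis by (simp add: D.add D.scaleR mink.add_left mink.scaleR_left algebra_simps)
  qed
  have add: "?nab p v (\<lambda>q. Y q + Z q) = ?nab p v Y + ?nab p v Z"
    if "p \<in> \<Omega>" "Y \<in> vfields \<Omega>" "Z \<in> vfields \<Omega>" "v \<in> tspace p" for p v Y Z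
    using deq[OF that(1,4) has_derivative_add[OF der[OF that(2,1)] der[OF that(3,1)]]]
    by (simp add: mink.add_left algebra_simps)
  have leib: "?nab p v (\<lambda>q. f q *\<^sub>R Y q) = differential \<Omega> f p v *\<^sub>R Y p + f p *\<^sub>R ?nab p v Y"
    if "p \<in> \<Omega>" "Y \<in> vfields \<Omega>" "v \<in> tspace p" "C1_surf \<Omega> f" for p v Y f
  proof -
    have "mink (Y p) p = 0" using that by (auto simp: vfields_def tspace_def)
    then show ?thesis
      using deq[OF that(1,3) has_derivative_scaleR[OF C1_surf_derivative[OF that(4,1)] der[OF that(2,1)]]]
      by (simp add: mink.add_left mink.scaleR_left algebra_simps)
  qed
  have met: "differential \<Omega> (\<lambda>q. mink (Y q) (Z q)) p v
          = mink (?nab p v Y) (Z p) + mink (Y p) (?nab p v Z)"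
    if "p \<in> \<Omega>" "Y \<in> vfields \<Omega>" "Z \<in> vfields \<Omega>" "v \<in> tspace p" for p v Y Z
  proof -
    have "mink p (Z p) = 0" "mink (Y p) p = 0"
      using that by (auto simp: vfields_def tspace_def mink_commute)
    then show ?thesis
      using deq[OF that(1,4) mink.FDERIV[OF der[OF that(2,1)] der[OF that(3,1)]]]
      by (simp add: mink.diff_left mink.diff_right mink.scaleR_left mink.scaleR_right)
  qed
  have tor: "differential \<Omega> f p (?nab p (X p) Y - ?nab p (Y p) X)
          = act \<Omega> X (act \<Omega> Y f) p - act \<Omega> Y (act \<Omega> X f) p"
    if p: "p \<in> \<Omega>" and X: "X \<in> vfields \<Omega>" and Y: "Y \<in> vfields \<Omega>" and f: "C2_surf \<Omega> f" for p X Y f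
  proof -
    obtain U F where U: "open U" "p \<in> U" "C2_open U F" "\<forall>x\<in>U \<inter> \<Omega>. F x = f x"
      using f p by (auto simp: C2_surf_def)
    obtain F' :: "L3 \<Rightarrow> (L3 \<Rightarrow>\<^sub>L real)" where
      F': "\<And>x. x \<in> U \<Longrightarrow> (F has_derivative blinfun_apply (F' x)) (at x)" "C1_open U F'"
      using U(3) unfolding C2_open_def by blast
    obtain F'' where F'': "(F' has_derivative F'') (at p)"
      using F'(2) U(2) unfolding C1_open_def by blast
    have df: "(f has_derivative blinfun_apply (F' p)) (at p within \<Omega>)"
      by (rule has_derivative_restrict[OF has_derivative_at_withinI[OF F'(1)] U(1)])
         (use p U in auto)
    have aa: "act \<Omega> V (act \<Omega> W f) p = F'' (V p) (W p) + F' p (differential \<Omega> W p (V p))"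
      if "V \<in> vfields \<Omega>" "W \<in> vfields \<Omega>" for V W
      by (rule act_act[OF e op p U(1,2,4) F'(1) F'' that])
    have sym: "F'' (X p) (Y p) = F'' (Y p) (X p)"
      by (rule second_derivative_symmetric[OF U(1,2) F'(1) F''])
    let ?a = "differential \<Omega> Y p (X p)" and ?b = "differential \<Omega> X p (Y p)"
    have pt: "X p \<in> tspace p" "Y p \<in> tspace p" using X Y p by (auto simp: vfields_def)
    have normal: "mink (differential \<Omega> W p v) p = - mink (W p) v"
      if "W \<in> vfields \<Omega>" "v \<in> tspace p" for W v
    proof -
      have "((\<lambda>q. mink (W q) q) has_derivative (\<lambda>h. mink (W p) h + mink (differential \<Omega> W p h) p))
          (at p within \<Omega>)"
        using mink.FDERIV[OF der[OF that(1) p] has_derivative_ident] .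
      moreover have "((\<lambda>q. mink (W q) q) has_derivative (\<lambda>h. 0)) (at p within \<Omega>)"
        by (rule has_derivative_transform[OF p _ has_derivative_const[of 0]])
           (use that in \<open>auto simp: vfields_def tspace_def\<close>)
      ultimately have "mink (W p) v + mink (differential \<Omega> W p v) p = 0"
        using derivative_tspace_unique[OF e op p that(2)] by blast
      then show ?thesis by simp
    qed
    have eq: "?nab p (X p) Y - ?nab p (Y p) X = ?a - ?b"
      using normal[OF Y pt(1)] normal[OF X pt(2)] by (simp add: mink_commute)
    have tn: "?nab p (X p) Y - ?nab p (Y p) X \<in> tspace p"
      using tan[OF p, of Y "X p"] tan[OF p, of X "Y p"] by (simp add: tspace_def mink.diff_left)
    have "differential \<Omega> f p (?nab p (X p) Y - ?nab p (Y p) X) = F' p (?a - ?b)"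
      by (subst deq[OF p tn df]) (simp only: eq)
    then show ?thesis
      using aa[OF X Y] aa[OF Y X] sym
      by (simp add: blinfun.diff_right)
  qed
  show ?thesis
    unfolding levi_civita_def affine_connection_def metric_compatible_def torsion_free_def
    by (intro conjI ballI allI impI) (rule tan lin add leib met tor; assumption)+
qed

end

theory Submission
  imports Defs
begin

text \<open>
  The surface \<open>Q \<epsilon>\<close> sits in \<open>L3\<close> with \<open>tspace p\<close> the \<open>mink\<close>-orthogonal complement of the
  position vector \<open>p\<close>, and \<open>mink p p = \<epsilon> \<noteq> 0\<close>. Hence \<open>L3\<close> splits at each point as
  \<open>tspace p \<oplus> \<real> p\<close>, and the Levi-Civita derivative is the tangential part of the ambient one:
  \<open>nab p v Y = dY v - \<epsilon> \<langle>dY v, p\<rangle> p\<close>. For a tangent field \<open>Y\<close>, differentiating \<open>\<langle>Y, p\<rangle> = 0\<close> gives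
  \<open>\<langle>dY v, p\<rangle> = - \<langle>Y p, v\<rangle>\<close>, so for \<open>Y = grad u\<close> this is the Gauss formula
  \<open>d (grad u) v = Hess u v - \<epsilon> du v p\<close>. The product rule gives
  \<open>d (\<epsilon> u p) v = \<epsilon> du v p + \<epsilon> u v\<close>; in the sum the two normal terms cancel, and what is left is
  \<open>Hess u v + \<epsilon> u v\<close>.

  Two points need work. First, a Levi-Civita connection is known only through its axioms, so it
  must be identified with the tangential part of the derivative
  (\<open>levi_civita_eq_tangential_derivative\<close>). This is the uniqueness half of the fundamental theorem
  of Riemannian geometry: by the axioms, the difference of two such connections, paired with a
  third field, is symmetric in two of its arguments and antisymmetric in two others, hence zero.
  Secondly, that identification concerns only \<open>C\<^sup>1\<close> tangent fields, so \<open>grad u\<close> must be seen to be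
  one (\<open>grad_vfields\<close>). Near each point it is the tangential part of the ambient \<open>mink\<close>-gradient of
  a \<open>C\<^sup>2\<close> extension of \<open>u\<close>.
\<close>

section \<open>Tangential projection\<close>

definition tproj :: "real \<Rightarrow> L3 \<Rightarrow> L3 \<Rightarrow> L3" where
  "tproj \<epsilon> p w = w - (\<epsilon> * mink w p) *\<^sub>R p"

lemma tproj_tspace:
  assumes "\<epsilon> \<in> {-1, 1}" "mink p p = \<epsilon>"
  shows "tproj \<epsilon> p w \<in> tspace p"
  using assms by (auto simp: tproj_def tspace_def mink.diff_left mink.scaleR_left)

lemma tproj_ident: "w \<in> tspace p \<Longrightarrow> tproj \<epsilon> p w = w"
  by (simp add: tproj_def tspace_def)

lemma mink_tproj_left: "v \<in> tspace p \<Longrightarrow> mink (tproj \<epsilon> p w) v = mink w v"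
  by (simp add: tproj_def tspace_def mink.diff_left mink.scaleR_left mink_commute[of p v])

lemma mink_nondegenerate:
  assumes "\<And>v. mink w v = 0"
  shows "w = 0"
  using assms[of "axis 1 1"] assms[of "axis 2 1"] assms[of "axis 3 1"]
  by (simp add: mink_def axis_def vec_eq_iff forall_3)

text \<open>The induced metric is nondegenerate because a vector tangent at \<open>p\<close> pairs with any ambient
  vector as it does with the tangential projection of that vector.\<close>

lemma mink_nondegenerate_tspace:
  assumes "\<epsilon> \<in> {-1, 1}" "mink p p = \<epsilon>" and w: "w \<in> tspace p"
    and orth: "\<And>v. v \<in> tspace p \<Longrightarrow> mink w v = 0"
  shows "w = 0"
proof (rule mink_nondegenerate)
  fix v
  have "mink w v = mink w (tproj \<epsilon> p v)"
    using mink_tproj_left[OF w, of \<epsilon> v] by (simp add: mink_commute)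
  then show "mink w v = 0" using orth[OF tproj_tspace[OF assms(1,2)]] by simp
qed

section \<open>Continuously differentiable maps\<close>

text \<open>On a finite-dimensional domain, continuity of the derivative in operator norm can be checked
  one direction at a time, so no operator-valued expression for the derivative is needed.\<close>

lemma C1_openI:
  assumes D: "\<And>x. x \<in> U \<Longrightarrow> (F has_derivative D x) (at x)"
    and cont: "\<And>v. continuous_on U (\<lambda>x. D x v)"
  shows "C1_open U F"
  unfolding C1_open_def
proof (intro exI conjI ballI)
  have bl: "blinfun_apply (Blinfun (D x)) = D x" if "x \<in> U" for x
    using has_derivative_bounded_linear[OF D[OF that]] by (rule bounded_linear_Blinfun_apply)
  show "(F has_derivative blinfun_apply (Blinfun (D x))) (at x)" if "x \<in> U" for x
    using D[OF that] bl[OF that] by simp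
  show "continuous_on U (\<lambda>x. Blinfun (D x))"
  proof (rule continuous_on_blinfun_componentwise)
    fix i :: L3
    show "continuous_on U (\<lambda>x. blinfun_apply (Blinfun (D x)) i)"
      using continuous_on_cong[THEN iffD2, OF refl _ cont[of i]] bl by simp
  qed
qed

lemma C1_open_const: "C1_open U (\<lambda>x. c)"
  by (rule C1_openI[where D = "\<lambda>x h. 0"]) auto

lemma C1_open_id: "C1_open U (\<lambda>x. x)"
  by (rule C1_openI[where D = "\<lambda>x h. h"]) auto

lemma C1_open_continuous_on: "C1_open U F \<Longrightarrow> continuous_on U F"
  unfolding C1_open_def
  by (meson continuous_at_imp_continuous_on has_derivative_continuous)

lemma C1_open_bounded_linear:
  assumes "bounded_linear L" "C1_open U F"
  shows "C1_open U (\<lambda>x. L (F x))"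
proof -
  obtain F' where F': "\<forall>x\<in>U. (F has_derivative blinfun_apply (F' x)) (at x)" "continuous_on U F'"
    using assms(2) unfolding C1_open_def by blast
  show ?thesis
  proof (rule C1_openI)
    show "((\<lambda>x. L (F x)) has_derivative (\<lambda>h. L (F' x h))) (at x)" if "x \<in> U" for x
      using bounded_linear.has_derivative[OF assms(1)] F'(1) that by blast
    show "continuous_on U (\<lambda>x. L (F' x v))" for v
      by (intro bounded_linear.continuous_on[OF assms(1)] continuous_intros F'(2))
  qed
qed

lemma C1_open_bounded_bilinear:
  assumes B: "bounded_bilinear B" and "C1_open U F" "C1_open U G"
  shows "C1_open U (\<lambda>x. B (F x) (G x))"
proof -
  obtain F' where F': "\<forall>x\<in>U. (F has_derivative blinfun_apply (F' x)) (at x)" "continuous_on U F'"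
    using assms(2) unfolding C1_open_def by blast
  obtain G' where G': "\<forall>x\<in>U. (G has_derivative blinfun_apply (G' x)) (at x)" "continuous_on U G'"
    using assms(3) unfolding C1_open_def by blast
  show ?thesis
  proof (rule C1_openI)
    show "((\<lambda>x. B (F x) (G x)) has_derivative (\<lambda>h. B (F x) (G' x h) + B (F' x h) (G x))) (at x)"
      if "x \<in> U" for x
      using bounded_bilinear.FDERIV[OF B] F'(1) G'(1) that by blast
    show "continuous_on U (\<lambda>x. B (F x) (G' x v) + B (F' x v) (G x))" for v
      by (intro continuous_on_add bounded_bilinear.continuous_on[OF B] C1_open_continuous_on
          assms(2,3) continuous_intros F'(2) G'(2))
  qed
qed

lemma C1_open_diff:
  assumes "C1_open U F" "C1_open U G"
  shows "C1_open U (\<lambda>x. F x - G x)"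
proof -
  obtain F' where F': "\<forall>x\<in>U. (F has_derivative blinfun_apply (F' x)) (at x)" "continuous_on U F'"
    using assms(1) unfolding C1_open_def by blast
  obtain G' where G': "\<forall>x\<in>U. (G has_derivative blinfun_apply (G' x)) (at x)" "continuous_on U G'"
    using assms(2) unfolding C1_open_def by blast
  show ?thesis
  proof (rule C1_openI)
    show "((\<lambda>x. F x - G x) has_derivative (\<lambda>h. F' x h - G' x h)) (at x)" if "x \<in> U" for x
      using has_derivative_diff F'(1) G'(1) that by blast
    show "continuous_on U (\<lambda>x. F' x v - G' x v)" for v
      by (intro continuous_intros F'(2) G'(2))
  qed
qed

lemma C1_open_tproj:
  assumes "C1_open U W"
  shows "C1_open U (\<lambda>x. tproj \<epsilon> x (W x))"
proof -
  have "C1_open U (\<lambda>x. \<epsilon> * mink (W x) x)"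
    by (rule C1_open_bounded_linear[OF bounded_linear_mult_right])
       (rule C1_open_bounded_bilinear[OF bounded_bilinear_mink assms C1_open_id])
  then show ?thesis
    unfolding tproj_def
    by (intro C1_open_diff assms C1_open_bounded_bilinear[OF bounded_bilinear_scaleR] C1_open_id)
qed

lemma C2_surf_imp_C1_surf:
  assumes "C2_surf \<Omega> f"
  shows "C1_surf \<Omega> f"
proof -
  have "C1_open U F" if "C2_open U F" for U and F :: "L3 \<Rightarrow> 'a"
    using that C1_open_continuous_on unfolding C2_open_def C1_open_def[of U F] by blast
  then show ?thesis using assms unfolding C2_surf_def C1_surf_def by meson
qed

lemma C2_surf_bounded_linear:
  assumes "bounded_linear L"
  shows "C2_surf \<Omega> L"
  unfolding C2_surf_def
proof (intro ballI exI conjI)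
  show "C2_open UNIV L"
    unfolding C2_open_def
    using bounded_linear_imp_has_derivative[OF assms] C1_open_const
    by (intro exI[of _ "\<lambda>x. Blinfun L"]) (simp add: bounded_linear_Blinfun_apply[OF assms])
qed auto

section \<open>Uniqueness of the Levi-Civita connection\<close>

lemma mink_self_of_openin:
  assumes "openin (top_of_set (Q \<epsilon>)) \<Omega>" "p \<in> \<Omega>"
  shows "mink p p = \<epsilon>"
  using assms by (auto simp: openin_open Q_def)

text \<open>The connection axioms speak of fields only; projecting a constant ambient field turns the
  resulting identities at a point into identities between arbitrary tangent vectors.\<close>

lemma vfield_through:
  assumes e: "\<epsilon> \<in> {-1, 1}" and op: "openin (top_of_set (Q \<epsilon>)) \<Omega>" and v: "v \<in> tspace p"
  obtains X where "X \<in> vfields \<Omega>" "X p = v"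
proof
  show "(\<lambda>q. tproj \<epsilon> q v) \<in> vfields \<Omega>"
    unfolding vfields_def C1_surf_def
    using tproj_tspace[OF e mink_self_of_openin[OF op]] C1_open_tproj[OF C1_open_const] open_UNIV
    by blast
qed (use v in \<open>simp add: tproj_ident\<close>)

lemma levi_civita_tspace:
  assumes "levi_civita \<Omega> nab" "p \<in> \<Omega>" "v \<in> tspace p" "Y \<in> vfields \<Omega>"
  shows "nab p v Y \<in> tspace p"
proof -
  have "\<forall>p\<in>\<Omega>. \<forall>Y\<in>vfields \<Omega>. \<forall>v\<in>tspace p. nab p v Y \<in> tspace p"
    using assms(1) unfolding levi_civita_def affine_connection_def by (elim conjE)
  then show ?thesis using assms(2-4) by blast
qed

text \<open>With \<open>D X Y\<close> the difference of the two covariant derivatives at \<open>p\<close>, torsion-freeness gives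
  \<open>D X Y = D Y X\<close> (test it on linear functions, whose differential is the function itself), and
  compatibility with the metric gives \<open>\<langle>D X Y, Z\<rangle> = - \<langle>Y, D X Z\<rangle>\<close>. The trilinear
  expression \<open>\<langle>D X Y, Z\<rangle>\<close> is then symmetric in the first pair of arguments and antisymmetric in the
  last pair, and such an expression vanishes.\<close>

lemma levi_civita_unique:
  assumes e: "\<epsilon> \<in> {-1, 1}" and op: "openin (top_of_set (Q \<epsilon>)) \<Omega>"
    and lc: "levi_civita \<Omega> nab" "levi_civita \<Omega> nab'"
    and p: "p \<in> \<Omega>" and v: "v \<in> tspace p" and Y: "Y \<in> vfields \<Omega>"
  shows "nab p v Y = nab' p v Y"
proof -
  define D where "D X Y = nab p (X p) Y - nab' p (X p) Y" for X Y
  have val: "X p \<in> tspace p" if "X \<in> vfields \<Omega>" for X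
    using that p by (simp add: vfields_def)
  have tan: "nab p v Y \<in> tspace p" "nab' p v Y \<in> tspace p"
    if "v \<in> tspace p" "Y \<in> vfields \<Omega>" for v Y
    using levi_civita_tspace[OF _ p that] lc by blast+
  have tdiff: "a - b \<in> tspace p" if "a \<in> tspace p" "b \<in> tspace p" for a b
    using that by (simp add: tspace_def mink.diff_left)
  have sym: "D X Y = D Y X" if X: "X \<in> vfields \<Omega>" and Y: "Y \<in> vfields \<Omega>" for X Y
  proof -
    let ?T = "nab p (X p) Y - nab p (Y p) X" and ?T' = "nab' p (X p) Y - nab' p (Y p) X"
    have t: "?T \<in> tspace p" "?T' \<in> tspace p"
      using X Y by (simp_all add: tdiff tan val)
    have "?T = ?T'"
    proof (rule vector_eq_ldot[THEN iffD1], rule allI)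
      fix c :: L3
      have L: "bounded_linear ((\<bullet>) c)" by (rule bounded_linear_inner_right)
      have "differential \<Omega> ((\<bullet>) c) p ?T = differential \<Omega> ((\<bullet>) c) p ?T'"
        using lc p X Y C2_surf_bounded_linear[OF L, of \<Omega>]
        unfolding levi_civita_def torsion_free_def by (metis (no_types, lifting))
      then show "c \<bullet> ?T = c \<bullet> ?T'"
        by (simp only: differential_eq[OF e op p _ bounded_linear_imp_has_derivative[OF L]] t)
    qed
    then show ?thesis by (simp add: D_def algebra_simps)
  qed
  have anti: "mink (D X Y) (Z p) = - mink (D X Z) (Y p)"
    if X: "X \<in> vfields \<Omega>" and Y: "Y \<in> vfields \<Omega>" and Z: "Z \<in> vfields \<Omega>" for X Y Z
  proof -
    have "differential \<Omega> (\<lambda>q. mink (Y q) (Z q)) p (X p)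
        = mink (n p (X p) Y) (Z p) + mink (Y p) (n p (X p) Z)" if "metric_compatible \<Omega> n" for n
      using that p Y Z val[OF X] unfolding metric_compatible_def by blast
    from this[of nab] this[of nab']
    have "mink (nab p (X p) Y) (Z p) + mink (Y p) (nab p (X p) Z)
        = mink (nab' p (X p) Y) (Z p) + mink (Y p) (nab' p (X p) Z)"
      using lc by (simp add: levi_civita_def)
    then show ?thesis
      by (simp add: D_def mink.diff_left mink_commute[of "Y p"])
  qed
  obtain X where X: "X \<in> vfields \<Omega>" "X p = v" using vfield_through[OF e op v] .
  have "D X Y = 0"
  proof (rule mink_nondegenerate_tspace[OF e mink_self_of_openin[OF op p]])
    show "D X Y \<in> tspace p" unfolding D_def X(2) using tdiff tan v Y by blast
    fix z assume z: "z \<in> tspace p"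
    obtain Z where Z: "Z \<in> vfields \<Omega>" "Z p = z" using vfield_through[OF e op z] .
    have "mink (D X Y) (Z p) = - mink (D Z X) (Y p)"
      using anti[OF X(1) Y Z(1)] sym[OF X(1) Z(1)] by simp
    also have "\<dots> = mink (D Y Z) (X p)"
      using anti[OF Z(1) X(1) Y] sym[OF Z(1) Y] by simp
    also have "\<dots> = - mink (D X Y) (Z p)"
      using anti[OF Y Z(1) X(1)] sym[OF Y X(1)] by simp
    finally show "mink (D X Y) z = 0" using Z(2) by simp
  qed
  then show ?thesis using X(2) by (simp add: D_def)
qed

text \<open>The existence proof exhibits the tangential part of the derivative as a Levi-Civita
  connection, so by uniqueness it is the only one.\<close>

lemma levi_civita_eq_tangential_derivative:
  assumes e: "\<epsilon> \<in> {-1, 1}" and op: "openin (top_of_set (Q \<epsilon>)) \<Omega>"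
    and "levi_civita \<Omega> nab" and "p \<in> \<Omega>" "v \<in> tspace p" "Y \<in> vfields \<Omega>"
  shows "nab p v Y = tproj \<epsilon> p (differential \<Omega> Y p v)"
  using levi_civita_unique[OF e op assms(3) levi_civita_exists[OF e op] assms(4-6)]
  by (simp add: tproj_def)

section \<open>The gradient\<close>

definition sharp :: "(L3 \<Rightarrow>\<^sub>L real) \<Rightarrow> L3" where
  "sharp \<phi> = \<phi> (axis 1 1) *\<^sub>R axis 1 1 + \<phi> (axis 2 1) *\<^sub>R axis 2 1 - \<phi> (axis 3 1) *\<^sub>R axis 3 1"

lemma bounded_linear_sharp: "bounded_linear sharp"
  unfolding sharp_def by (intro bounded_linear_intros)

lemma mink_sharp: "mink (sharp \<phi>) v = \<phi> v"
proof -
  have "v = v $ 1 *\<^sub>R axis 1 1 + v $ 2 *\<^sub>R axis 2 1 + v $ 3 *\<^sub>R axis 3 1"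
    by (simp add: vec_eq_iff forall_3 axis_def)
  then have "\<phi> v = \<phi> (v $ 1 *\<^sub>R axis 1 1 + v $ 2 *\<^sub>R axis 2 1 + v $ 3 *\<^sub>R axis 3 1)"
    by simp
  also have "\<dots> = v $ 1 * \<phi> (axis 1 1) + v $ 2 * \<phi> (axis 2 1) + v $ 3 * \<phi> (axis 3 1)"
    by (simp add: blinfun.add_right blinfun.scaleR_right)
  finally show ?thesis
    by (simp add: sharp_def mink_def axis_def mult.commute)
qed

lemma grad_eqI:
  assumes e: "\<epsilon> \<in> {-1, 1}" and pp: "mink p p = \<epsilon>" and w: "w \<in> tspace p"
    and rep: "\<And>v. v \<in> tspace p \<Longrightarrow> mink w v = differential \<Omega> u p v"
  shows "grad \<Omega> u p = w"
  unfolding grad_def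
proof (rule the_equality)
  fix w' assume w': "w' \<in> tspace p \<and> (\<forall>v\<in>tspace p. mink w' v = differential \<Omega> u p v)"
  have "w' - w = 0"
    using w w' rep by (intro mink_nondegenerate_tspace[OF e pp]) (auto simp: tspace_def mink.diff_left)
  then show "w' = w" by simp
qed (use w rep in blast)

lemma grad_eq_tproj_sharp:
  assumes e: "\<epsilon> \<in> {-1, 1}" and op: "openin (top_of_set (Q \<epsilon>)) \<Omega>" and p: "p \<in> \<Omega>"
    and u: "(u has_derivative blinfun_apply \<phi>) (at p within \<Omega>)"
  shows "grad \<Omega> u p = tproj \<epsilon> p (sharp \<phi>)"
proof -
  have pp: "mink p p = \<epsilon>" using mink_self_of_openin[OF op p] .
  show ?thesis
    by (rule grad_eqI[OF e pp tproj_tspace[OF e pp]])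
       (simp add: mink_tproj_left mink_sharp differential_eq[OF e op p _ u])
qed

lemma grad_characterization:
  assumes e: "\<epsilon> \<in> {-1, 1}" and op: "openin (top_of_set (Q \<epsilon>)) \<Omega>" and u: "C1_surf \<Omega> u"
    and p: "p \<in> \<Omega>"
  shows "grad \<Omega> u p \<in> tspace p"
    and "v \<in> tspace p \<Longrightarrow> mink (grad \<Omega> u p) v = differential \<Omega> u p v"
proof -
  have pp: "mink p p = \<epsilon>" using mink_self_of_openin[OF op p] .
  have du: "(u has_derivative differential \<Omega> u p) (at p within \<Omega>)"
    using C1_surf_derivative[OF u p] .
  define \<phi> where "\<phi> = Blinfun (differential \<Omega> u p)"
  have \<phi>: "blinfun_apply \<phi> = differential \<Omega> u p"
    unfolding \<phi>_def using has_derivative_bounded_linear[OF du] by (rule bounded_linear_Blinfun_apply)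
  have g: "grad \<Omega> u p = tproj \<epsilon> p (sharp \<phi>)"
    using grad_eq_tproj_sharp[OF e op p] du \<phi> by simp
  show "grad \<Omega> u p \<in> tspace p"
    unfolding g by (rule tproj_tspace[OF e pp])
  show "v \<in> tspace p \<Longrightarrow> mink (grad \<Omega> u p) v = differential \<Omega> u p v"
    by (simp add: g mink_tproj_left mink_sharp \<phi>)
qed

text \<open>If \<open>F\<close> is a local \<open>C\<^sup>2\<close> extension of \<open>u\<close>, then \<open>tproj \<epsilon> x (sharp (F' x))\<close> is a \<open>C\<^sup>1\<close> map on
  an open subset of \<open>L3\<close>, and it extends the gradient of \<open>u\<close>.\<close>

lemma grad_vfields:
  assumes e: "\<epsilon> \<in> {-1, 1}" and op: "openin (top_of_set (Q \<epsilon>)) \<Omega>" and u: "C2_surf \<Omega> u"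
  shows "grad \<Omega> u \<in> vfields \<Omega>"
proof -
  have "\<exists>U G. open U \<and> p \<in> U \<and> C1_open U G \<and> (\<forall>x\<in>U \<inter> \<Omega>. G x = grad \<Omega> u x)" if p: "p \<in> \<Omega>" for p
  proof -
    obtain U F where U: "open U" "p \<in> U" "C2_open U F" "\<forall>x\<in>U \<inter> \<Omega>. F x = u x"
      using u p unfolding C2_surf_def by blast
    obtain F' :: "L3 \<Rightarrow> (L3 \<Rightarrow>\<^sub>L real)" where
      F': "\<And>x. x \<in> U \<Longrightarrow> (F has_derivative blinfun_apply (F' x)) (at x)" "C1_open U F'"
      using U(3) unfolding C2_open_def by blast
    have "tproj \<epsilon> x (sharp (F' x)) = grad \<Omega> u x" if "x \<in> U \<inter> \<Omega>" for x
    proof -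
      have "(u has_derivative blinfun_apply (F' x)) (at x within \<Omega>)"
        by (rule has_derivative_restrict[OF has_derivative_at_withinI[OF F'(1)] U(1)])
           (use that U(4) in auto)
      then show ?thesis using grad_eq_tproj_sharp[OF e op] that by simp
    qed
    moreover have "C1_open U (\<lambda>x. tproj \<epsilon> x (sharp (F' x)))"
      by (intro C1_open_tproj C1_open_bounded_linear[OF bounded_linear_sharp] F'(2))
    ultimately show ?thesis using U(1,2) by blast
  qed
  then show ?thesis
    using grad_characterization(1)[OF e op C2_surf_imp_C1_surf[OF u]]
    unfolding vfields_def C1_surf_def by blast
qed

section \<open>The differential of \<open>Xmap\<close>\<close>

lemma vfields_derivative:
  assumes "Y \<in> vfields \<Omega>" "p \<in> \<Omega>"
  shows "(Y has_derivative differential \<Omega> Y p) (at p within \<Omega>)"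
  using assms C1_surf_derivative by (auto simp: vfields_def)

text \<open>Differentiate \<open>mink (Y q) q = 0\<close>: the normal part of the derivative of a tangent field does
  not involve derivatives of the field.\<close>

lemma mink_differential_vfield:
  assumes e: "\<epsilon> \<in> {-1, 1}" and op: "openin (top_of_set (Q \<epsilon>)) \<Omega>" and p: "p \<in> \<Omega>"
    and Y: "Y \<in> vfields \<Omega>" and v: "v \<in> tspace p"
  shows "mink (differential \<Omega> Y p v) p = - mink (Y p) v"
proof -
  have "(Y has_derivative differential \<Omega> Y p) (at p within \<Omega>)"
    using vfields_derivative[OF Y p] .
  then have "((\<lambda>q. mink (Y q) q) has_derivative (\<lambda>h. mink (Y p) h + mink (differential \<Omega> Y p h) p))
      (at p within \<Omega>)"
    using mink.FDERIV has_derivative_ident by blast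
  moreover have "((\<lambda>q. mink (Y q) q) has_derivative (\<lambda>h. 0)) (at p within \<Omega>)"
    by (rule has_derivative_transform[OF p _ has_derivative_const[of 0]])
       (use Y in \<open>auto simp: vfields_def tspace_def\<close>)
  ultimately have "mink (Y p) v + mink (differential \<Omega> Y p v) p = 0"
    using derivative_tspace_unique[OF e op p v] by blast
  then show ?thesis by simp
qed

theorem proposition2p1:
  fixes \<epsilon> :: real and \<Omega> :: "L3 set" and u :: "L3 \<Rightarrow> real" and nab :: conn
  assumes "\<epsilon> \<in> {-1, 1}"
    and "domain_in \<epsilon> \<Omega>"
    and "C2_surf \<Omega> u"
    and "levi_civita \<Omega> nab"
  shows "\<forall>p\<in>\<Omega>.
      Xmap \<epsilon> \<Omega> u differentiable (at p within \<Omega>) \<and>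
      (\<forall>v\<in>tspace p. differential \<Omega> (Xmap \<epsilon> \<Omega> u) p v = Hess \<Omega> nab u p v + (\<epsilon> * u p) *\<^sub>R v) \<and>
      differential \<Omega> (Xmap \<epsilon> \<Omega> u) p ` tspace p \<subseteq> tspace p \<and>
      mink (Xmap \<epsilon> \<Omega> u p) p = u p"
proof
  fix p assume p: "p \<in> \<Omega>"
  note e = assms(1)
  have op: "openin (top_of_set (Q \<epsilon>)) \<Omega>" using assms(2) by (simp add: domain_in_def)
  have C1: "C1_surf \<Omega> u" using C2_surf_imp_C1_surf[OF assms(3)] .
  have gv: "grad \<Omega> u \<in> vfields \<Omega>" using grad_vfields[OF e op assms(3)] .
  let ?du = "differential \<Omega> u p" and ?dg = "differential \<Omega> (grad \<Omega> u) p"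
  have du: "(u has_derivative ?du) (at p within \<Omega>)" using C1_surf_derivative[OF C1 p] .
  have dg: "(grad \<Omega> u has_derivative ?dg) (at p within \<Omega>)"
    using vfields_derivative[OF gv p] .
  have X: "(Xmap \<epsilon> \<Omega> u has_derivative (\<lambda>h. (\<epsilon> * u p) *\<^sub>R h + (\<epsilon> * ?du h) *\<^sub>R p + ?dg h)) (at p within \<Omega>)"
    unfolding Xmap_def[abs_def]
    by (rule has_derivative_eq_rhs, rule has_derivative_add[OF has_derivative_scaleR dg],
        rule has_derivative_mult_right[OF du], rule has_derivative_ident) simp
  have dX: "differential \<Omega> (Xmap \<epsilon> \<Omega> u) p v = Hess \<Omega> nab u p v + (\<epsilon> * u p) *\<^sub>R v"
    if v: "v \<in> tspace p" for v
  proof -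
    have "mink (?dg v) p = - ?du v"
      using mink_differential_vfield[OF e op p gv v] grad_characterization(2)[OF e op C1 p v] by simp
    \<comment> \<open>Gauss formula: the normal part of \<open>?dg v\<close> cancels the normal term produced by \<open>\<epsilon> u p\<close>.\<close>
    then have "Hess \<Omega> nab u p v = ?dg v + (\<epsilon> * ?du v) *\<^sub>R p"
      unfolding Hess_def levi_civita_eq_tangential_derivative[OF e op assms(4) p v gv]
      by (simp add: tproj_def)
    then show ?thesis unfolding differential_eq[OF e op p v X] by simp
  qed
  have "differential \<Omega> (Xmap \<epsilon> \<Omega> u) p v \<in> tspace p" if v: "v \<in> tspace p" for v
    using levi_civita_tspace[OF assms(4) p v gv] v
    unfolding dX[OF v] Hess_def by (simp add: tspace_def mink.add_left mink.scaleR_left)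
  moreover have "mink (Xmap \<epsilon> \<Omega> u p) p = u p"
    using grad_characterization(1)[OF e op C1 p] mink_self_of_openin[OF op p] e
    by (auto simp: Xmap_def tspace_def mink.add_left mink.scaleR_left)
  ultimately show "Xmap \<epsilon> \<Omega> u differentiable (at p within \<Omega>) \<and>
      (\<forall>v\<in>tspace p. differential \<Omega> (Xmap \<epsilon> \<Omega> u) p v = Hess \<Omega> nab u p v + (\<epsilon> * u p) *\<^sub>R v) \<and>
      differential \<Omega> (Xmap \<epsilon> \<Omega> u) p ` tspace p \<subseteq> tspace p \<and>
      mink (Xmap \<epsilon> \<Omega> u p) p = u p"
    using X dX unfolding differentiable_def by blast
qed

end
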